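(* Let $m\geq 2$, let $N$ be a real $s\times s$ nilpotent matrix of index $k$, and let $A=A_m(N)$. Then $A$ is nilpotent of index $r$ for some $r\leq 2k+1$. Further, if both the first row and the first column of $N^{k-1}$ contain at least one nonzero entry, then $A$ has index $r=2k+1$.
   Context: The index of a nilpotent matrix $N$ is the smallest positive integer $k$ with $N^k=0$ (and $N^0=I$). For an $s\times s$ nilpotent matrix $N$ and $m\ge 2$, $A_m(N)$ is the $(ms+1)\times(ms+1)$ matrix given in block form by $$A_m(N)=\begin{bmatrix} 0 & \mathbf{e}^T & \mathbf{e}^T & \cdots & \mathbf{e}^T\\ (1-m)\mathbf{e} & N & 0 & \cdots & 0\\ \mathbf{e} & 0 & N & \ddots & \vdots\\ \vdots & \vdots & \ddots & \ddots & 0\\ \mathbf{e} & 0 & \cdots & 0 & N\end{bmatrix},$$ with $m$ diagonal blocks equal to $N$, where $\mathbf{e}^T=[1\ 0\ \cdots\ 0]$ has length $s$; in the first block column, the first of the $m$ blocks below the top entry is $(1-m)\mathbf{e}$ and the remaining $m-1$ are $\mathbf{e}$. *)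

theory Defs
  imports "Jordan_Normal_Form.Matrix"
begin

text \<open>\<^term>\<open>nilpotent_of_index N k\<close>: the square matrix \<^term>\<open>N\<close> is nilpotent, and \<^term>\<open>k\<close> is the
  smallest positive exponent whose power vanishes. In particular the index of a zero matrix is 1.\<close>

definition nilpotent_of_index :: "'a :: semiring_1 mat \<Rightarrow> nat \<Rightarrow> bool" where
  "nilpotent_of_index N k \<longleftrightarrow> square_mat N \<and> 0 < k \<and>
     N ^\<^sub>m k = 0\<^sub>m (dim_row N) (dim_row N) \<and>
     (\<forall>j. 0 < j \<and> N ^\<^sub>m j = 0\<^sub>m (dim_row N) (dim_row N) \<longrightarrow> k \<le> j)"

text \<open>The vector \<open>e = [1, 0, \<dots>, 0]\<close> of length \<open>s\<close> is \<open>unit_vec s 0\<close> (indices start at 0).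
  The first block row to the right of the corner is \<open>m\<close> copies of the transpose of \<open>e\<close>;
  the first block column below the corner is \<open>(1 - m) e\<close> followed by \<open>m - 1\<close> copies of \<open>e\<close>.
  Entry \<open>i\<close> of such a stack of \<open>m\<close> blocks of length \<open>s\<close> lies in block \<open>i div s\<close> at position
  \<open>i mod s\<close>. The coefficient \<open>1 - m\<close> is computed in the ring, not with truncated subtraction.\<close>

definition A_mat :: "nat \<Rightarrow> 'a :: comm_ring_1 mat \<Rightarrow> 'a mat" where
  "A_mat m N = (let s = dim_row N; e = unit_vec s 0 in
     four_block_mat
       (0\<^sub>m 1 1)
       (mat 1 (m * s) (\<lambda>(i, j). e $ (j mod s)))
       (mat (m * s) 1 (\<lambda>(i, j). (if i div s = 0 then 1 - of_nat m else 1) * e $ (i mod s)))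
       (diag_block_mat (replicate m N)))"

lemma A_mat_carrier:
  assumes "N \<in> carrier_mat s s"
  shows "A_mat m N \<in> carrier_mat (m * s + 1) (m * s + 1)"
  using assms by (auto simp: A_mat_def Let_def dim_diag_block_mat sum_list_replicate)

end

theory Submission
  imports Defs
begin

text \<open>
  Write the matrix as \<open>A = [0, u; w, D]\<close>, where \<open>D\<close> is block diagonal with \<open>m\<close> copies of \<open>N\<close>.
  The row \<open>u\<close> treats the \<open>m\<close> blocks alike, while the coefficients \<open>1 - m, 1, \<dots>, 1\<close> of the
  column \<open>w\<close> add up to zero. Hence \<open>u D\<^sup>j w = 0\<close> for every \<open>j\<close>. Reading a power of \<open>A\<close> as
  a weighted sum of walks, this says that all walks returning to the corner cancel, so only walks
  visiting the corner at most once contribute: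
  \<open>A\<^sup>n\<^sup>+\<^sup>1 = [0, u D\<^sup>n; D\<^sup>n w, D\<^sup>n\<^sup>+\<^sup>1 + S\<^sub>n]\<close>, where \<open>S\<^sub>n\<close> is the sum of
  \<open>D\<^sup>i w u D\<^sup>j\<close> over \<open>i + j = n - 1\<close> (lemma \<open>pow_bordered_mat\<close>).

  Let \<open>N\<^sup>k = 0\<close>, so that \<open>D\<^sup>k = 0\<close>. If \<open>i + j = 2k - 1\<close>, then \<open>i \<ge> k\<close> or \<open>j \<ge> k\<close>; so
  \<open>S\<^sub>2\<^sub>k = 0\<close> and \<open>A\<^sup>2\<^sup>k\<^sup>+\<^sup>1 = 0\<close>. If \<open>i + j = 2k - 2\<close>, the only term that can survive has
  \<open>i = j = k - 1\<close>, so \<open>A\<^sup>2\<^sup>k\<close> contains the rank-one block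
  \<open>(D\<^sup>k\<^sup>-\<^sup>1 w) (u D\<^sup>k\<^sup>-\<^sup>1)\<close> (lemma \<open>pow_bordered_mat_rank_one_block\<close>). Its column factor consists of
  multiples of the first column of \<open>N\<^sup>k\<^sup>-\<^sup>1\<close> and its row factor of copies of the first row. If
  neither of the two vanishes, then \<open>A\<^sup>2\<^sup>k \<noteq> 0\<close>, and the index is exactly \<open>2k + 1\<close>.
\<close>

section \<open>Powers of a bordered matrix\<close>

lemma pow_mat_add:
  assumes "A \<in> carrier_mat n n"
  shows "A ^\<^sub>m (i + j) = A ^\<^sub>m i * A ^\<^sub>m j"
proof (induction j)
  case 0
  show ?case using assms by simp
next
  case (Suc j)
  then show ?case using assms by (simp add: assoc_mult_mat[of _ n n _ n _ n])
qed

lemma index_col_mult_row: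
  fixes X Y :: "'a :: semiring_0 mat"
  assumes "X \<in> carrier_mat p 1" "Y \<in> carrier_mat 1 q" "i < p" "j < q"
  shows "(X * Y) $$ (i, j) = X $$ (i, 0) * Y $$ (0, j)"
  using assms by (simp add: scalar_prod_def)

text \<open>
  The sum of \<open>D\<^sup>i w u D\<^sup>j\<close> over all \<open>i + j = n - 1\<close>: the weight of those walks of length
  \<open>n + 1\<close> that start and end off the corner and pass through it exactly once. The recursion splits
  off the term \<open>j = 0\<close>; it makes finite sums of matrices unnecessary.
\<close>

primrec detour_sum :: "'a :: semiring_1 mat \<Rightarrow> 'a mat \<Rightarrow> 'a mat \<Rightarrow> nat \<Rightarrow> 'a mat" where
  "detour_sum u w D 0 = 0\<^sub>m (dim_row D) (dim_row D)"
| "detour_sum u w D (Suc n) = detour_sum u w D n * D + D ^\<^sub>m n * w * u"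

context
  fixes u w D :: "'a :: semiring_1 mat" and p :: nat
  assumes u: "u \<in> carrier_mat 1 p"
    and w: "w \<in> carrier_mat p 1"
    and D: "D \<in> carrier_mat p p"
begin

lemma detour_sum_carrier: "detour_sum u w D n \<in> carrier_mat p p"
  using u w D by (induction n) auto

text \<open>
  Continuing a detour so that it ends in the corner again closes a walk from the corner to itself, so
  the hypothesis removes every term. The factor \<open>D\<^sup>j\<close> has to be general for the induction, since
  each step of the recursion moves one \<open>D\<close> to the right factor.
\<close>

lemma detour_sum_mult_border:
  assumes inv: "\<And>j. u * (D ^\<^sub>m j * w) = 0\<^sub>m 1 1"
  shows "detour_sum u w D n * (D ^\<^sub>m j * w) = 0\<^sub>m p 1"
proof (induction n arbitrary: j)
  case 0
  show ?case using w D by (simp add: left_mult_zero_mat[of _ p 1])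
next
  case (Suc n)
  let ?S = "detour_sum u w D n"
  have c: "?S \<in> carrier_mat p p" "D ^\<^sub>m n \<in> carrier_mat p p" "D ^\<^sub>m j * w \<in> carrier_mat p 1"
    "D ^\<^sub>m n * w \<in> carrier_mat p 1"
    using detour_sum_carrier w D by auto
  have "D * (D ^\<^sub>m j * w) = D ^\<^sub>m Suc j * w"
    using pow_mat_add[OF D, of 1 j] D w by (simp add: assoc_mult_mat[of _ p p _ p _ 1])
  then have 1: "?S * D * (D ^\<^sub>m j * w) = 0\<^sub>m p 1"
    using Suc.IH[of "Suc j"] assoc_mult_mat[OF c(1) D c(3)] by simp
  have "D ^\<^sub>m n * w * u * (D ^\<^sub>m j * w) = 0\<^sub>m p 1"
    using assoc_mult_mat[OF c(4) u c(3)] inv[of j] c(4) by (simp add: right_mult_zero_mat)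
  with 1 show ?case
    using c u D by (simp add: add_mult_distrib_mat[of _ p p _ _ 1])
qed

text \<open>
  Multiplying once more by the bordered matrix, every product that re-enters the corner contains some
  \<open>u D\<^sup>j w\<close> and vanishes; what remains is the recursion of \<^const>\<open>detour_sum\<close>.
\<close>

lemma pow_bordered_mat:
  assumes inv: "\<And>j. u * (D ^\<^sub>m j * w) = 0\<^sub>m 1 1"
  shows "four_block_mat (0\<^sub>m 1 1) u w D ^\<^sub>m Suc n =
    four_block_mat (0\<^sub>m 1 1) (u * D ^\<^sub>m n) (D ^\<^sub>m n * w) (D ^\<^sub>m Suc n + detour_sum u w D n)"
proof (induction n)
  case 0
  show ?case using u w D by simp
next
  case (Suc n)
  let ?S = "detour_sum u w D n"
  have c: "?S \<in> carrier_mat p p" "D ^\<^sub>m n \<in> carrier_mat p p" "D ^\<^sub>m Suc n \<in> carrier_mat p p"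
     "u * D ^\<^sub>m n \<in> carrier_mat 1 p" "D ^\<^sub>m n * w \<in> carrier_mat p 1"
     "D ^\<^sub>m Suc n + ?S \<in> carrier_mat p p"
    using detour_sum_carrier u w D by auto
  have TL: "0\<^sub>m 1 1 * 0\<^sub>m 1 1 + u * D ^\<^sub>m n * w = 0\<^sub>m 1 1"
    using inv[of n] assoc_mult_mat[OF u c(2) w] by simp
  have TR: "0\<^sub>m 1 1 * u + u * D ^\<^sub>m n * D = u * D ^\<^sub>m Suc n"
    using assoc_mult_mat[OF u c(2) D] left_mult_zero_mat[OF u, of 1]
      left_add_zero_mat[OF mult_carrier_mat[OF u c(3)]] by simp
  have "?S * w = 0\<^sub>m p 1"
    using detour_sum_mult_border[OF inv, of n 0] w D by simp
  then have BL: "D ^\<^sub>m n * w * 0\<^sub>m 1 1 + (D ^\<^sub>m Suc n + ?S) * w = D ^\<^sub>m Suc n * w"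
    by (simp only: add_mult_distrib_mat[OF c(3) c(1) w] right_mult_zero_mat[OF c(5)]
      left_add_zero_mat[OF mult_carrier_mat[OF c(3) w]]
      right_add_zero_mat[OF mult_carrier_mat[OF c(3) w]])
  have c': "?S * D \<in> carrier_mat p p" "D ^\<^sub>m n * w * u \<in> carrier_mat p p"
    "D ^\<^sub>m Suc (Suc n) \<in> carrier_mat p p"
    by (rule mult_carrier_mat[OF c(1) D] mult_carrier_mat[OF c(5) u] pow_carrier_mat[OF D])+
  have "D ^\<^sub>m n * w * u + (D ^\<^sub>m Suc (Suc n) + ?S * D) =
     D ^\<^sub>m Suc (Suc n) + (?S * D + D ^\<^sub>m n * w * u)"
    unfolding comm_add_mat[OF c'(2) add_carrier_mat[OF c'(1)]]
    by (rule assoc_add_mat[OF c'(3,1,2)])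
  then have BR: "D ^\<^sub>m n * w * u + (D ^\<^sub>m Suc n + ?S) * D =
      D ^\<^sub>m Suc (Suc n) + detour_sum u w D (Suc n)"
    by (simp only: add_mult_distrib_mat[OF c(3) c(1) D] detour_sum.simps pow_mat.simps(2)[of D "Suc n"])
  have "four_block_mat (0\<^sub>m 1 1) u w D ^\<^sub>m Suc (Suc n) =
    four_block_mat (0\<^sub>m 1 1) (u * D ^\<^sub>m n) (D ^\<^sub>m n * w) (D ^\<^sub>m Suc n + ?S) *
    four_block_mat (0\<^sub>m 1 1) u w D"
    unfolding Suc.IH[symmetric] by (rule pow_mat.simps)
  also have "\<dots> = four_block_mat (0\<^sub>m 1 1) (u * D ^\<^sub>m Suc n) (D ^\<^sub>m Suc n * w)
      (D ^\<^sub>m Suc (Suc n) + detour_sum u w D (Suc n))"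
    by (subst mult_four_block_mat[OF zero_carrier_mat c(4,5,6) zero_carrier_mat u w D])
      (simp only: TL TR BL BR)
  finally show ?case .
qed

text \<open>
  Once \<open>D\<^sup>n = 0\<close>, the recursion adds no new terms and only multiplies by \<open>D\<close>. This replaces
  the count of exponents \<open>i, j\<close> in the explicit sum, both for the vanishing of \<open>A\<^sup>2\<^sup>k\<^sup>+\<^sup>1\<close> and
  for the surviving term of \<open>A\<^sup>2\<^sup>k\<close>.
\<close>

lemma detour_sum_add:
  assumes "D ^\<^sub>m n = 0\<^sub>m p p"
  shows "detour_sum u w D (n + j) = detour_sum u w D n * D ^\<^sub>m j"
proof (induction j)
  case 0
  show ?case using detour_sum_carrier[of n] D by simp
next
  case (Suc j)
  have c: "detour_sum u w D n \<in> carrier_mat p p" "D ^\<^sub>m j \<in> carrier_mat p p"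
    using detour_sum_carrier D by auto
  have "D ^\<^sub>m (n + j) = 0\<^sub>m p p"
    using assms c by (simp add: pow_mat_add[OF D] left_mult_zero_mat)
  then have "D ^\<^sub>m (n + j) * w * u = 0\<^sub>m p p"
    using u w by (simp add: left_mult_zero_mat[OF w] left_mult_zero_mat[OF u])
  then show ?case
    using Suc.IH assoc_mult_mat[OF c D] right_add_zero_mat[OF mult_carrier_mat[OF mult_carrier_mat[OF c] D]]
    by simp
qed

lemma pow_bordered_mat_eq_0:
  assumes inv: "\<And>j. u * (D ^\<^sub>m j * w) = 0\<^sub>m 1 1" and nil: "D ^\<^sub>m k = 0\<^sub>m p p"
  shows "four_block_mat (0\<^sub>m 1 1) u w D ^\<^sub>m (2 * k + 1) = 0\<^sub>m (1 + p) (1 + p)"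
proof -
  have 1: "D ^\<^sub>m (k + k) = 0\<^sub>m p p"
    using nil by (simp add: pow_mat_add[OF D] left_mult_zero_mat[of _ p p])
  have 2: "detour_sum u w D (k + k) = 0\<^sub>m p p"
    using detour_sum_add[OF nil, of k] nil detour_sum_carrier[of k]
    by (simp add: right_mult_zero_mat[of _ p p])
  have 3: "u * D ^\<^sub>m (k + k) = 0\<^sub>m 1 p" "D ^\<^sub>m (k + k) * w = 0\<^sub>m p 1"
     "D ^\<^sub>m Suc (k + k) = 0\<^sub>m p p"
    using 1 u w D by (auto simp: right_mult_zero_mat[OF u] left_mult_zero_mat[OF w]
      left_mult_zero_mat[OF D])
  have e: "2 * k + 1 = Suc (k + k)" by simp
  show ?thesis
    unfolding e pow_bordered_mat[OF inv] 2 3 by simp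
qed

text \<open>
  With \<open>k = n + 1\<close>, the lower right block of \<open>A\<^sup>2\<^sup>k\<close> is
  \<open>S\<^sub>k D\<^sup>n = (S\<^sub>n D + D\<^sup>n w u) D\<^sup>n\<close>, and \<open>D D\<^sup>n = 0\<close> leaves the product of a column and
  a row.
\<close>

lemma pow_bordered_mat_rank_one_block:
  assumes inv: "\<And>j. u * (D ^\<^sub>m j * w) = 0\<^sub>m 1 1" and nil: "D ^\<^sub>m Suc n = 0\<^sub>m p p"
    and i: "i < p" and j: "j < p"
  shows "(four_block_mat (0\<^sub>m 1 1) u w D ^\<^sub>m (2 * Suc n)) $$ (Suc i, Suc j) =
    (D ^\<^sub>m n * w) $$ (i, 0) * (u * D ^\<^sub>m n) $$ (0, j)"
proof -
  let ?S = "detour_sum u w D n"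
  have c: "?S \<in> carrier_mat p p" "D ^\<^sub>m n \<in> carrier_mat p p" "D ^\<^sub>m n * w \<in> carrier_mat p 1"
    "u * D ^\<^sub>m n \<in> carrier_mat 1 p"
    using detour_sum_carrier u w D by auto
  have e: "2 * Suc n = Suc (Suc n + n)" by simp
  have "D ^\<^sub>m (Suc n + n) = 0\<^sub>m p p"
    unfolding pow_mat_add[OF D] nil using c(2) by (rule left_mult_zero_mat)
  then have 1: "D ^\<^sub>m Suc (Suc n + n) = 0\<^sub>m p p"
    by (simp add: left_mult_zero_mat[OF D])
  have "?S * D * D ^\<^sub>m n = ?S * D ^\<^sub>m Suc n"
    using assoc_mult_mat[OF c(1) D c(2)] pow_mat_add[OF D, of 1 n] D by simp
  also have "\<dots> = 0\<^sub>m p p" unfolding nil using c(1) by (rule right_mult_zero_mat)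
  finally have 2: "?S * D * D ^\<^sub>m n = 0\<^sub>m p p" .
  have "detour_sum u w D (Suc n + n) = (?S * D + D ^\<^sub>m n * w * u) * D ^\<^sub>m n"
    using detour_sum_add[OF nil, of n] by simp
  also have "\<dots> = ?S * D * D ^\<^sub>m n + D ^\<^sub>m n * w * u * D ^\<^sub>m n"
    using c u D by (intro add_mult_distrib_mat[of _ p p _ _ p]) auto
  also have "\<dots> = D ^\<^sub>m n * w * (u * D ^\<^sub>m n)"
    using 2 assoc_mult_mat[OF c(3) u c(2)] c by (simp add: mult_carrier_mat[of _ p 1 _ p])
  finally have 3: "detour_sum u w D (Suc n + n) = D ^\<^sub>m n * w * (u * D ^\<^sub>m n)" .
  show ?thesis
    unfolding e pow_bordered_mat[OF inv] 1 3
    using i j D by (simp add: index_col_mult_row[OF c(3,4)] del: pow_mat.simps index_mult_mat(1))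
qed

end

section \<open>Block diagonal matrices with equal blocks\<close>

lemma index_diag_block_replicate:
  fixes M :: "'a :: zero mat"
  assumes M: "M \<in> carrier_mat s s" and "i < m * s" "j < m * s"
  shows "diag_block_mat (replicate m M) $$ (i, j) =
    (if i div s = j div s then M $$ (i mod s, j mod s) else 0)"
  using assms(2,3)
proof (induction m arbitrary: i j)
  case (Suc m)
  let ?B = "diag_block_mat (replicate m M)"
  have s: "0 < s" using Suc.prems by (cases s) auto
  have B: "?B \<in> carrier_mat (m * s) (m * s)"
    using M by (auto simp: dim_diag_block_mat sum_list_replicate)
  have *: "diag_block_mat (replicate (Suc m) M) $$ (i, j) =
     (if i < s then if j < s then M $$ (i, j) else 0
      else if j < s then 0 else ?B $$ (i - s, j - s))"
    using M B Suc.prems by (auto simp: Let_def)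
  show ?case
  proof (cases "i < s \<or> j < s")
    case True
    then show ?thesis using * s by (auto simp: div_eq_0_iff)
  next
    case False
    then have "i - s < m * s" "j - s < m * s" using Suc.prems by auto
    then show ?thesis using False * Suc.IH s by (auto simp: le_div_geq le_mod_geq)
  qed
qed simp

text \<open>
  A row of \<open>m\<close> copies of \<open>e\<^sup>T\<close> selects the first row of each diagonal block: in column \<open>j\<close>
  only the index \<open>(j div s) * s\<close>, the first one of the block of \<open>j\<close>, contributes.
\<close>

lemma row_stack_mult_diag_block:
  fixes M :: "'a :: semiring_1 mat"
  assumes M: "M \<in> carrier_mat s s"
  shows "mat 1 (m * s) (\<lambda>(i, j). unit_vec s 0 $ (j mod s)) * diag_block_mat (replicate m M) =
    mat 1 (m * s) (\<lambda>(i, j). M $$ (0, j mod s))" (is "?u * ?B = _")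
proof (rule eq_matI)
  fix i j assume "i < dim_row (mat 1 (m * s) (\<lambda>(i, j). M $$ (0, j mod s)))"
    and "j < dim_col (mat 1 (m * s) (\<lambda>(i, j). M $$ (0, j mod s)))"
  then have i: "i = 0" and j: "j < m * s" by auto
  have s: "0 < s" using j by (cases s) auto
  have B: "?B \<in> carrier_mat (m * s) (m * s)"
    using M by (auto simp: dim_diag_block_mat sum_list_replicate)
  let ?l = "j div s * s"
  have l: "?l < m * s" using j s by (simp add: div_less_iff_less_mult)
  have "(?u * ?B) $$ (i, j) = (\<Sum>l<m * s. unit_vec s 0 $ (l mod s) * ?B $$ (l, j))"
    using i j B by (simp add: scalar_prod_def atLeast0LessThan)
  also have "\<dots> = (\<Sum>l<m * s. if l = ?l then M $$ (0, j mod s) else 0)"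
  proof (rule sum.cong)
    fix l assume "l \<in> {..<m * s}"
    then have l': "l < m * s" by simp
    have "l = ?l \<longleftrightarrow> l div s = j div s \<and> l mod s = 0"
      using s by auto
    then show "unit_vec s 0 $ (l mod s) * ?B $$ (l, j) = (if l = ?l then M $$ (0, j mod s) else 0)"
      using s index_diag_block_replicate[OF M l' j] by auto
  qed simp
  also have "\<dots> = M $$ (0, j mod s)" using l by simp
  finally show "(?u * ?B) $$ (i, j) = mat 1 (m * s) (\<lambda>(i, j). M $$ (0, j mod s)) $$ (i, j)"
    using i j by simp
qed (use M in \<open>auto simp: dim_diag_block_mat sum_list_replicate\<close>)

lemma diag_block_mult_col_stack:
  fixes M :: "'a :: comm_semiring_1 mat" and c :: "nat \<Rightarrow> 'a"
  assumes M: "M \<in> carrier_mat s s"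
  shows "diag_block_mat (replicate m M) * mat (m * s) 1 (\<lambda>(i, j). c (i div s) * unit_vec s 0 $ (i mod s)) =
    mat (m * s) 1 (\<lambda>(i, j). c (i div s) * M $$ (i mod s, 0))" (is "?B * ?w = ?R")
proof (rule eq_matI)
  fix i j assume "i < dim_row ?R" and "j < dim_col ?R"
  then have j: "j = 0" and i: "i < m * s" by auto
  have s: "0 < s" using i by (cases s) auto
  have B: "?B \<in> carrier_mat (m * s) (m * s)"
    using M by (auto simp: dim_diag_block_mat sum_list_replicate)
  let ?l = "i div s * s"
  have l: "?l < m * s" using i s by (simp add: div_less_iff_less_mult)
  have "(?B * ?w) $$ (i, j) = (\<Sum>l<m * s. ?B $$ (i, l) * (c (l div s) * unit_vec s 0 $ (l mod s)))"
    using i j B by (simp add: scalar_prod_def atLeast0LessThan)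
  also have "\<dots> = (\<Sum>l<m * s. if l = ?l then c (i div s) * M $$ (i mod s, 0) else 0)"
  proof (rule sum.cong)
    fix l assume "l \<in> {..<m * s}"
    then have l': "l < m * s" by simp
    have "l = ?l \<longleftrightarrow> l div s = i div s \<and> l mod s = 0"
      using s by auto
    then show "?B $$ (i, l) * (c (l div s) * unit_vec s 0 $ (l mod s)) =
        (if l = ?l then c (i div s) * M $$ (i mod s, 0) else 0)"
      using s index_diag_block_replicate[OF M i l'] by (auto simp: mult.commute)
  qed simp
  also have "\<dots> = c (i div s) * M $$ (i mod s, 0)" using l by simp
  finally show "(?B * ?w) $$ (i, j) = ?R $$ (i, j)"
    using i j by simp
qed (use M in \<open>auto simp: dim_diag_block_mat sum_list_replicate\<close>)

text \<open>
  The sum over all indices splits into the \<open>m\<close> blocks, and block \<open>b\<close> contributes \<open>c b\<close> times a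
  number that does not depend on \<open>b\<close>. This is where the choice of the coefficients
  \<open>1 - m, 1, \<dots>, 1\<close> enters.
\<close>

lemma row_stack_mult_col_stack:
  fixes M :: "'a :: comm_semiring_1 mat" and c :: "nat \<Rightarrow> 'a"
  assumes M: "M \<in> carrier_mat s s" and c: "(\<Sum>b<m. c b) = 0"
  shows "mat 1 (m * s) (\<lambda>(i, j). unit_vec s 0 $ (j mod s)) *
    mat (m * s) 1 (\<lambda>(i, j). c (i div s) * M $$ (i mod s, 0)) = 0\<^sub>m 1 1" (is "?u * ?w = _")
proof (rule eq_matI)
  fix i j assume "i < dim_row (0\<^sub>m 1 1 :: 'a mat)" "j < dim_col (0\<^sub>m 1 1 :: 'a mat)"
  then have ij: "i = 0" "j = 0" by auto
  let ?f = "\<lambda>l. unit_vec s 0 $ (l mod s) * (c (l div s) * M $$ (l mod s, 0))"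
  have "(?u * ?w) $$ (i, j) = (\<Sum>l<m * s. ?f l)"
    using ij by (simp add: scalar_prod_def atLeast0LessThan)
  also have "\<dots> = (\<Sum>b<m. \<Sum>l = b * s..<b * s + s. ?f l)"
    by (rule sum.nat_group[symmetric])
  also have "\<dots> = (\<Sum>b<m. c b * (\<Sum>r<s. unit_vec s 0 $ r * M $$ (r, 0)))"
  proof (rule sum.cong)
    fix b
    have "(\<Sum>l = b * s..<b * s + s. ?f l) = (\<Sum>r<s. ?f (r + b * s))"
      using sum.shift_bounds_nat_ivl[of ?f 0 "b * s" s] by (simp add: atLeast0LessThan add.commute)
    also have "\<dots> = c b * (\<Sum>r<s. unit_vec s 0 $ r * M $$ (r, 0))"
      unfolding sum_distrib_left by (rule sum.cong) (auto simp: mult.left_commute)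
    finally show "(\<Sum>l = b * s..<b * s + s. ?f l) = \<dots>" .
  qed simp
  also have "\<dots> = 0"
    using c by (simp flip: sum_distrib_right)
  finally show "(?u * ?w) $$ (i, j) = 0\<^sub>m 1 1 $$ (i, j)" using ij by simp
qed auto

section \<open>The index of nilpotency\<close>

lemma nilpotent_of_index_exists_le:
  assumes "A \<in> carrier_mat n n" "0 < q" "A ^\<^sub>m q = 0\<^sub>m n n"
  shows "\<exists>r. nilpotent_of_index A r \<and> r \<le> q"
proof -
  define r where "r = (LEAST r. 0 < r \<and> A ^\<^sub>m r = 0\<^sub>m n n)"
  have "0 < r \<and> A ^\<^sub>m r = 0\<^sub>m n n"
    unfolding r_def by (rule LeastI[of _ q]) (use assms in auto)
  moreover have "r \<le> j" if "0 < j" "A ^\<^sub>m j = 0\<^sub>m n n" for j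
    unfolding r_def by (rule Least_le) (use that in auto)
  ultimately show ?thesis
    using assms unfolding nilpotent_of_index_def by auto
qed

lemma nilpotent_of_index_gt:
  assumes A: "A \<in> carrier_mat n n" and r: "nilpotent_of_index A r" and q: "A ^\<^sub>m q \<noteq> 0\<^sub>m n n"
  shows "q < r"
proof (rule ccontr)
  assume "\<not> q < r"
  then have "A ^\<^sub>m q = A ^\<^sub>m r * A ^\<^sub>m (q - r)"
    using pow_mat_add[OF A, of r "q - r"] by simp
  moreover have "A ^\<^sub>m r = 0\<^sub>m n n" using A r by (auto simp: nilpotent_of_index_def)
  moreover have "A ^\<^sub>m (q - r) \<in> carrier_mat n n" using A by simp
  ultimately show False using q by (simp add: left_mult_zero_mat)
qed

theorem theorem2p3:
  fixes N :: "real mat" and m s k :: nat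
  assumes "2 \<le> m" and "1 \<le> s" and "N \<in> carrier_mat s s" and "nilpotent_of_index N k"
  shows "\<exists>r. nilpotent_of_index (A_mat m N) r \<and> r \<le> 2 * k + 1 \<and>
    ((\<exists>j<s. (N ^\<^sub>m (k - 1)) $$ (0, j) \<noteq> 0) \<and> (\<exists>i<s. (N ^\<^sub>m (k - 1)) $$ (i, 0) \<noteq> 0)
      \<longrightarrow> r = 2 * k + 1)"
proof -
  note N = \<open>N \<in> carrier_mat s s\<close>
  define c :: "nat \<Rightarrow> real" where "c b = (if b = 0 then 1 - of_nat m else 1)" for b
  define u :: "real mat" where "u = mat 1 (m * s) (\<lambda>(i, j). unit_vec s 0 $ (j mod s))"
  define w where "w = mat (m * s) 1 (\<lambda>(i, j). c (i div s) * unit_vec s 0 $ (i mod s))"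
  define D where "D = diag_block_mat (replicate m N)"
  have A: "A_mat m N = four_block_mat (0\<^sub>m 1 1) u w D"
    using N by (simp add: A_mat_def Let_def u_def w_def D_def c_def)
  have u: "u \<in> carrier_mat 1 (m * s)" and w: "w \<in> carrier_mat (m * s) 1"
    and D: "D \<in> carrier_mat (m * s) (m * s)"
    using N by (auto simp: u_def w_def D_def dim_diag_block_mat sum_list_replicate)
  have Ac: "A_mat m N \<in> carrier_mat (1 + m * s) (1 + m * s)"
    using A_mat_carrier[OF N, of m] by simp
  have k: "0 < k" and Nk: "N ^\<^sub>m k = 0\<^sub>m s s"
    using \<open>nilpotent_of_index N k\<close> N by (auto simp: nilpotent_of_index_def)
  have Nc: "N ^\<^sub>m n \<in> carrier_mat s s" for n using N by simp
  have Dn: "D ^\<^sub>m n = diag_block_mat (replicate m (N ^\<^sub>m n))" for n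
    using N by (simp add: D_def diag_block_pow_mat)
  have Dk: "D ^\<^sub>m k = 0\<^sub>m (m * s) (m * s)"
  proof (rule eq_matI)
    fix i j assume "i < dim_row (0\<^sub>m (m * s) (m * s) :: real mat)"
      "j < dim_col (0\<^sub>m (m * s) (m * s) :: real mat)"
    then show "(D ^\<^sub>m k) $$ (i, j) = 0\<^sub>m (m * s) (m * s) $$ (i, j)"
      using index_diag_block_replicate[OF Nc, of i m j k] \<open>1 \<le> s\<close> by (simp add: Dn Nk)
  qed (use D k in auto)
  have uD: "u * D ^\<^sub>m n = mat 1 (m * s) (\<lambda>(i, j). (N ^\<^sub>m n) $$ (0, j mod s))" for n
    unfolding Dn u_def by (rule row_stack_mult_diag_block[OF Nc])
  have Dw: "D ^\<^sub>m n * w = mat (m * s) 1 (\<lambda>(i, j). c (i div s) * (N ^\<^sub>m n) $$ (i mod s, 0))" for n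
    unfolding Dn w_def by (rule diag_block_mult_col_stack[OF Nc])
  obtain m' where m': "m = Suc m'" using \<open>2 \<le> m\<close> by (cases m) auto
  have "(\<Sum>b<m. c b) = 0"
    unfolding m' sum.lessThan_Suc_shift by (simp add: c_def m')
  then have inv: "u * (D ^\<^sub>m n * w) = 0\<^sub>m 1 1" for n
    unfolding Dw u_def by (rule row_stack_mult_col_stack[OF Nc])
  have "A_mat m N ^\<^sub>m (2 * k + 1) = 0\<^sub>m (1 + m * s) (1 + m * s)"
    unfolding A by (rule pow_bordered_mat_eq_0[OF u w D inv Dk])
  from nilpotent_of_index_exists_le[OF Ac _ this]
  obtain r where r: "nilpotent_of_index (A_mat m N) r" "r \<le> 2 * k + 1"
    by auto
  have "r = 2 * k + 1" if j: "j < s" "(N ^\<^sub>m (k - 1)) $$ (0, j) \<noteq> 0"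
    and i: "i < s" "(N ^\<^sub>m (k - 1)) $$ (i, 0) \<noteq> 0" for i j
  proof -
    \<comment> \<open>The nonzero entry is read off in the second block of rows, where the coefficient of \<open>w\<close>
      is 1, and in the first block of columns. The outer \<open>Suc\<close> skips the corner.\<close>
    have "2 * s \<le> m * s" using \<open>2 \<le> m\<close> by simp
    then have le: "s + i < m * s" "j < m * s" using i j by linarith+
    have k': "Suc (k - 1) = k" using k by simp
    have "(A_mat m N ^\<^sub>m (2 * k)) $$ (Suc (s + i), Suc j) =
        (D ^\<^sub>m (k - 1) * w) $$ (s + i, 0) * (u * D ^\<^sub>m (k - 1)) $$ (0, j)"
      unfolding A using pow_bordered_mat_rank_one_block[OF u w D inv _ le, of "k - 1"] Dk
      by (simp only: k')
    also have "\<dots> = (N ^\<^sub>m (k - 1)) $$ (i, 0) * (N ^\<^sub>m (k - 1)) $$ (0, j)"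
      using le i j by (simp add: uD Dw c_def)
    finally have "(A_mat m N ^\<^sub>m (2 * k)) $$ (Suc (s + i), Suc j) \<noteq> 0"
      using i j by simp
    then have "A_mat m N ^\<^sub>m (2 * k) \<noteq> 0\<^sub>m (1 + m * s) (1 + m * s)"
      using le by auto
    from nilpotent_of_index_gt[OF Ac r(1) this] r(2) show ?thesis by simp
  qed
  with r show ?thesis by blast
qed

end
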